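(* Let $\mu$ be a finite Borel measure on $\mathbb{R}^d$, let $1\le p_0<p_1<\infty$, and let $q_0,q_1$ be the conjugate exponents to $p_0,p_1$ respectively. If a Borel measure $\nu$ on $\mathbb{R}^d$ is both a $(p_0,q_0)$-Bessel measure and a $(p_1,q_1)$-Bessel measure for $\mu$, then $\nu$ is also a $(p,q)$-Bessel measure for $\mu$ for every $p$ with $p_0<p<p_1$, where $q$ is the conjugate exponent to $p$.
   Context: For $t\in\mathbb{R}^d$ let $e_t(x)=e^{2\pi i t\cdot x}$. For a finite Borel measure $\mu$ on $\mathbb{R}^d$, put $\widehat{f d\mu}(t)=\int f(x)e^{-2\pi i t\cdot x}\,d\mu(x)$ for $f\in L^1(\mu)$, $t\in\mathbb{R}^d$. For $1\le p<\infty$ the compatible semi-inner product on $L^p(\mu)$ is $$[f,g]_{L^p(\mu)}=\frac{1}{\|g\|_{L^p(\mu)}^{p-2}}\int f(x)\,|g(x)|^{p-1}\,\overline{\mathrm{sgn}(g(x))}\,d\mu(x)$$ if $\|g\|_{L^p(\mu)}\neq0$, and $0$ otherwise (where $\mathrm{sgn}(z)=z/|z|$ for $z\ne0$, $\mathrm{sgn}(0)=0$). For conjugate exponents $1<p,q<\infty$, a Borel measure $\nu$ on $\mathbb{R}^d$ is a $(p,q)$-Bessel measure for $\mu$ if there is $B>0$ with $\int_{\mathbb{R}^d}|[f,e_t]_{L^p(\mu)}|^q\,d\nu(t)\le B\|f\|_{L^p(\mu)}^q$ for all $f\in L^p(\mu)$. For $p=1$, $q=\infty$, the condition is $\|\widehat{f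 d\mu}\|_\infty\le B\|f\|_{L^1(\mu)}$ for all $f\in L^1(\mu)$, where $\|\cdot\|_\infty$ is the norm of $L^\infty(\nu)$. *)

theory Defs
  imports "HOL-Probability.Essential_Supremum"
begin

text \<open>Elements of \<open>L\<^sup>p(\<mu>)\<close> are represented by functions rather than by classes of functions modulo
  equality almost everywhere; all notions below are invariant under changes on null sets.\<close>

definition Lp_space :: "real \<Rightarrow> 'a measure \<Rightarrow> ('a \<Rightarrow> complex) set" where
  "Lp_space p \<mu> =
    {f. f \<in> borel_measurable \<mu> \<and> integrable \<mu> (\<lambda>x. cmod (f x) powr p)}"

definition Lp_norm :: "real \<Rightarrow> 'a measure \<Rightarrow> ('a \<Rightarrow> complex) \<Rightarrow> real" where
  "Lp_norm p \<mu> f = (\<integral>x. cmod (f x) powr p \<partial>\<mu>) powr (1 / p)"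

text \<open>For \<open>p = 1\<close>, HOL's convention \<open>0 powr 0 = 0\<close> is harmless here since \<open>sgn 0 = 0\<close>.\<close>

definition semi_inner :: "real \<Rightarrow> 'a measure \<Rightarrow> ('a \<Rightarrow> complex) \<Rightarrow> ('a \<Rightarrow> complex) \<Rightarrow> complex" where
  "semi_inner p \<mu> f g =
    (if Lp_norm p \<mu> g \<noteq> 0
     then of_real (1 / Lp_norm p \<mu> g powr (p - 2)) *
       (\<integral>x. f x * of_real (cmod (g x) powr (p - 1)) * cnj (sgn (g x)) \<partial>\<mu>)
     else 0)"

definition expo :: "real ^ 'd \<Rightarrow> real ^ 'd \<Rightarrow> complex" where
  "expo t x = exp (2 * of_real pi * \<i> * of_real (t \<bullet> x))"

definition fourier_measure ::
    "(real ^ 'd) measure \<Rightarrow> (real ^ 'd \<Rightarrow> complex) \<Rightarrow> real ^ 'd \<Rightarrow> complex" where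
  "fourier_measure \<mu> f t = (\<integral>x. f x * exp (- 2 * of_real pi * \<i> * of_real (t \<bullet> x)) \<partial>\<mu>)"

text \<open>The first exponent is always finite, the second one may be \<open>\<infinity>\<close> (with \<open>1 / \<infinity> = 0\<close>).\<close>

definition conjugate_exponents :: "real \<Rightarrow> ennreal \<Rightarrow> bool" where
  "conjugate_exponents p q \<longleftrightarrow> 1 \<le> p \<and> 1 / ennreal p + 1 / q = 1"

text \<open>Only meaningful for conjugate exponents, so that \<open>q = \<infinity>\<close> is exactly the case \<open>p = 1\<close>.
  Integral and essential supremum with respect to \<open>\<nu>\<close> are taken in the extended nonnegative
  reals, so that the inequalities include the finiteness of their left-hand sides.\<close>

definition bessel_measure ::
    "real \<Rightarrow> ennreal \<Rightarrow> (real ^ 'd) measure \<Rightarrow> (real ^ 'd) measure \<Rightarrow> bool" where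
  "bessel_measure p q \<mu> \<nu> \<longleftrightarrow>
    (if q = \<infinity>
     then \<exists>B::real. B > 0 \<and> (\<forall>f \<in> Lp_space p \<mu>.
        esssup \<nu> (\<lambda>t. ennreal (cmod (fourier_measure \<mu> f t))) \<le> ennreal (B * Lp_norm p \<mu> f))
     else \<exists>B::real. B > 0 \<and> (\<forall>f \<in> Lp_space p \<mu>.
        (\<integral>\<^sup>+t. ennreal (cmod (semi_inner p \<mu> f (expo t)) powr enn2real q) \<partial>\<nu>)
          \<le> ennreal (B * Lp_norm p \<mu> f powr enn2real q)))"

end

theory Submission
  imports Defs "HOL-Complex_Analysis.Complex_Analysis" "HOL-Real_Asymp.Real_Asymp"
begin

text \<open>
  Since \<open>\<bar>e\<^sub>t\<bar> = 1\<close>, the semi-inner product \<open>[f, e\<^sub>t]\<close> is the Fourier transform of \<open>f d\<mu>\<close> at \<open>t\<close>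
  times a constant that depends only on \<open>p\<close> and the total mass of \<open>\<mu>\<close>. Being a \<open>(p,q)\<close>-Bessel
  measure therefore means that one fixed operator, \<open>f \<mapsto> (f d\<mu>)^\<close>, is bounded from \<open>L\<^sup>p(\<mu>)\<close> to
  \<open>L\<^sup>q(\<nu>)\<close>, and the assertion is an instance of Riesz--Thorin interpolation. The complex method
  is used because real interpolation would require \<open>p \<le> q\<close>, which fails as soon as \<open>p > 2\<close>.

  Because \<open>q\<close> is conjugate to \<open>p\<close>, the dual exponent of \<open>L\<^sup>q(\<nu>)\<close> is \<open>p\<close> again, so the bilinear
  form \<open>A(f,g) = \<integral> (f d\<mu>)^ g d\<nu>\<close> is measured in the same exponent on both sides. This gives a
  symmetric interpolation statement (\<open>bilinear_riesz_thorin\<close>): if \<open>\<bar>A\<bar> \<le> C\<close> on the unit spheres for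
  the exponents \<open>p\<^sub>0\<close> and \<open>p\<^sub>1\<close>, then also for \<open>p\<close>. With \<open>P(z) = (1-z)/p\<^sub>0 + z/p\<^sub>1\<close>, the functions
  \<open>f\<^sub>z = sgn f \<cdot> \<bar>f\<bar> powr (p P(z))\<close> and \<open>g\<^sub>z\<close> are unit vectors for \<open>p\<^sub>0\<close> on \<open>Re z = 0\<close> and for \<open>p\<^sub>1\<close> on
  \<open>Re z = 1\<close>, and they are \<open>f\<close> and \<open>g\<close> at \<open>z = \<theta>\<close>; the maximum principle in the strip
  (\<open>strip_maximum_principle\<close>) applied to \<open>z \<mapsto> A(f\<^sub>z, g\<^sub>z)\<close> bounds \<open>A(f,g)\<close>. One constant at both
  endpoints suffices, since the asserted inequality does not ask for the sharp constant.

  The endpoint bounds on \<open>A\<close> come from the Bessel conditions by Young's inequality, or by the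
  essential supremum when \<open>p\<^sub>0 = 1\<close> (\<open>pairing_bound_of_bessel\<close>). To return from \<open>A\<close> to the operator,
  \<open>A\<close> is tested against \<open>g = cnj (sgn F) (\<bar>F\<bar>/\<parallel>F\<parallel>\<^sub>q) powr (q/p)\<close> with \<open>F = (f d\<mu>)^\<close>, for which
  \<open>A(f,g) = \<parallel>F\<parallel>\<^sub>q\<close> (\<open>fourier_bound_on_level_set\<close>). All analytic questions are trivialised by first
  taking \<open>\<bar>f\<bar>\<close> and \<open>\<bar>g\<bar>\<close> bounded above and bounded away from \<open>0\<close> off their zero sets, and
  by restricting \<open>\<nu>\<close> to a level set \<open>{\<bar>F\<bar> \<ge> d}\<close>, which has finite measure because the second
  endpoint exponent \<open>q\<^sub>1\<close> is finite. Two applications of Fatou's lemma remove these restrictions.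
\<close>

section \<open>Holomorphic functions in a strip\<close>

text \<open>The factor \<open>exp (\<epsilon> (z\<^sup>2 - 1))\<close> has modulus at most \<open>exp (- \<epsilon> (Im z)\<^sup>2)\<close> in the strip, so the
  damped function is small on the short sides of a tall rectangle and the maximum principle for
  rectangles applies; then \<open>\<epsilon>\<close> tends to \<open>0\<close>.\<close>

lemma strip_maximum_principle:
  fixes \<Phi> :: "complex \<Rightarrow> complex"
  assumes hol: "\<Phi> holomorphic_on UNIV"
    and C: "C > 0"
    and bdd: "\<And>z. 0 \<le> Re z \<Longrightarrow> Re z \<le> 1 \<Longrightarrow> cmod (\<Phi> z) \<le> L"
    and left: "\<And>z. Re z = 0 \<Longrightarrow> cmod (\<Phi> z) \<le> C"
    and right: "\<And>z. Re z = 1 \<Longrightarrow> cmod (\<Phi> z) \<le> C"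
    and z: "0 \<le> Re z" "Re z \<le> 1"
  shows "cmod (\<Phi> z) \<le> C"
proof -
  have damped: "cmod (\<Phi> z * exp (of_real \<epsilon> * (z\<^sup>2 - 1))) \<le> C" if \<epsilon>: "\<epsilon> > 0" for \<epsilon> :: real
  proof -
    define G where "G = (\<lambda>z. \<Phi> z * exp (of_real \<epsilon> * (z\<^sup>2 - 1)))"
    have Gle: "cmod (G v) \<le> cmod (\<Phi> v) * exp (- \<epsilon> * (Im v)\<^sup>2)" if "0 \<le> Re v" "Re v \<le> 1" for v
    proof -
      have "Re (v\<^sup>2 - 1) \<le> - (Im v)\<^sup>2"
        using that by (simp add: power2_eq_square mult_le_one)
      hence "\<epsilon> * Re (v\<^sup>2 - 1) \<le> \<epsilon> * - (Im v)\<^sup>2" using \<epsilon> by (intro mult_left_mono) auto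
      hence "cmod (exp (of_real \<epsilon> * (v\<^sup>2 - 1))) \<le> exp (- \<epsilon> * (Im v)\<^sup>2)"
        by simp
      thus ?thesis unfolding G_def norm_mult by (intro mult_left_mono) auto
    qed
    have "((\<lambda>R. L * exp (- \<epsilon> * R\<^sup>2)) \<longlongrightarrow> 0) at_top" using \<epsilon> by real_asymp
    hence "eventually (\<lambda>R. L * exp (- \<epsilon> * R\<^sup>2) < C) at_top" using C by (rule order_tendstoD)
    hence "eventually (\<lambda>R. L * exp (- \<epsilon> * R\<^sup>2) < C \<and> R > \<bar>Im z\<bar>) at_top"
      by (intro eventually_conj eventually_gt_at_top)
    then obtain R where R: "L * exp (- \<epsilon> * R\<^sup>2) < C" "R > \<bar>Im z\<bar>"
      by (auto dest: eventually_happens)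
    have holG: "G holomorphic_on UNIV" unfolding G_def by (intro holomorphic_intros hol)
    have "cmod (G z) \<le> C"
    proof (rule maximum_modulus_frontier[where f = G and \<xi> = z and S = "cbox (Complex 0 (-R)) (Complex 1 R)"])
      show "G holomorphic_on interior (cbox (Complex 0 (-R)) (Complex 1 R))"
        using holG by (rule holomorphic_on_subset) auto
      show "continuous_on (closure (cbox (Complex 0 (-R)) (Complex 1 R))) G"
        using holomorphic_on_imp_continuous_on[OF holG] continuous_on_subset by blast
      show "z \<in> cbox (Complex 0 (-R)) (Complex 1 R)"
        using R z by (auto simp: in_cbox_complex_iff)
      fix v assume "v \<in> frontier (cbox (Complex 0 (-R)) (Complex 1 R))"
      hence v: "0 \<le> Re v" "Re v \<le> 1" "Re v = 0 \<or> Re v = 1 \<or> \<bar>Im v\<bar> = R"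
        by (auto simp: frontier_cbox in_cbox_complex_iff in_box_complex_iff)
      show "cmod (G v) \<le> C"
      proof (cases "\<bar>Im v\<bar> = R")
        case True
        hence "cmod (G v) \<le> cmod (\<Phi> v) * exp (- \<epsilon> * R\<^sup>2)" using Gle[OF v(1,2)] by auto
        also have "\<dots> \<le> L * exp (- \<epsilon> * R\<^sup>2)" by (intro mult_right_mono bdd v) auto
        finally show ?thesis using R by simp
      next
        case False
        hence "cmod (\<Phi> v) \<le> C" using v left right by blast
        moreover have "exp (- \<epsilon> * (Im v)\<^sup>2) \<le> 1" using \<epsilon> by simp
        ultimately have "cmod (\<Phi> v) * exp (- \<epsilon> * (Im v)\<^sup>2) \<le> C * 1"
          using C by (intro mult_mono) auto
        thus ?thesis using Gle[OF v(1,2)] by simp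
      qed
    qed auto
    thus ?thesis by (simp add: G_def)
  qed
  have "((\<lambda>\<epsilon>. cmod (\<Phi> z * exp (of_real \<epsilon> * (z\<^sup>2 - 1)))) \<longlongrightarrow>
      cmod (\<Phi> z * exp (of_real 0 * (z\<^sup>2 - 1)))) (at_right 0)"
    by (intro tendsto_intros)
  hence "cmod (\<Phi> z * exp (of_real 0 * (z\<^sup>2 - 1))) \<le> C"
    by (rule tendsto_upperbound)
       (auto simp: damped intro!: eventually_mono[OF eventually_at_right_less[of 0]])
  thus ?thesis by simp
qed

text \<open>For bounded \<open>w\<close> and \<open>u\<close> the exponential series may be integrated term by term, which makes
  the integral a power series in \<open>z\<close> converging everywhere.\<close>

lemma holomorphic_integral_exp:
  fixes w :: "'a \<Rightarrow> complex" and u :: "'a \<Rightarrow> real"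
  assumes M: "finite_measure M"
    and [measurable]: "w \<in> borel_measurable M" "u \<in> borel_measurable M"
    and W: "\<And>x. x \<in> space M \<Longrightarrow> cmod (w x) \<le> W"
    and U: "\<And>x. x \<in> space M \<Longrightarrow> \<bar>u x\<bar> \<le> U"
  shows "(\<lambda>z. \<integral>x. w x * exp (z * of_real (u x)) \<partial>M) holomorphic_on UNIV"
proof -
  interpret finite_measure M by fact
  define I where "I = (\<lambda>z. \<integral>x. w x * exp (z * of_real (u x)) \<partial>M)"
  define a where "a = (\<lambda>n. \<integral>x. w x * of_real (u x) ^ n / fact n \<partial>M)"
  have I_sums: "(\<lambda>n. a n * (z - 0) ^ n) sums I z" for z
  proof -
    define T where "T = (\<lambda>n x. w x * of_real (u x) ^ n / fact n * z ^ n)"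
    have [measurable]: "T n \<in> borel_measurable M" for n unfolding T_def by measurable
    have T_norm: "norm (T n x) \<le> W * ((U * cmod z) ^ n / fact n)" if "x \<in> space M" for n x
    proof -
      have "norm (T n x) = cmod (w x) * (\<bar>u x\<bar> ^ n * cmod z ^ n / fact n)"
        by (simp add: T_def norm_mult norm_divide norm_power)
      also have "\<dots> \<le> W * (U ^ n * cmod z ^ n / fact n)"
        using W[OF that] U[OF that] order_trans[OF norm_ge_zero W[OF that]]
        by (intro mult_mono divide_right_mono power_mono) auto
      finally show ?thesis by (simp add: power_mult_distrib)
    qed
    have T_sums: "(\<lambda>n. T n x) sums (w x * exp (z * of_real (u x)))" for x
    proof -
      have "(\<lambda>n. (z * of_real (u x)) ^ n /\<^sub>R fact n) sums exp (z * of_real (u x))"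
        by (rule exp_converges)
      from sums_mult[OF this, of "w x"] show ?thesis
        by (simp add: T_def power_mult_distrib scaleR_conv_of_real field_simps)
    qed
    have exp_summable: "summable (\<lambda>n. W * ((U * cmod z) ^ n / fact n))"
      using summable_exp[of "U * cmod z"] by (intro summable_mult) (simp add: field_simps)
    have int_T: "integrable M (T n)" for n
      by (rule integrable_const_bound[where B = "W * ((U * cmod z) ^ n / fact n)"])
         (use T_norm in \<open>auto intro!: AE_I2\<close>)
    have "(\<lambda>n. integral\<^sup>L M (T n)) sums (\<integral>x. (\<Sum>n. T n x) \<partial>M)"
    proof (rule sums_integral)
      show "AE x in M. summable (\<lambda>n. norm (T n x))"
        by (rule AE_I2, rule summable_comparison_test'[OF exp_summable])
           (use T_norm in auto)
      show "summable (\<lambda>n. \<integral>x. norm (T n x) \<partial>M)"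
      proof (rule summable_comparison_test')
        show "summable (\<lambda>n. measure M (space M) * (W * ((U * cmod z) ^ n / fact n)))"
          using exp_summable by (rule summable_mult)
        fix n
        have "(\<integral>x. norm (T n x) \<partial>M) \<le> (\<integral>x. W * ((U * cmod z) ^ n / fact n) \<partial>M)"
          by (intro integral_mono integrable_norm int_T T_norm) auto
        thus "norm (\<integral>x. norm (T n x) \<partial>M) \<le> measure M (space M) * (W * ((U * cmod z) ^ n / fact n))"
          by simp
      qed
    qed (rule int_T)
    also have "(\<lambda>n. integral\<^sup>L M (T n)) = (\<lambda>n. a n * (z - 0) ^ n)"
      by (simp add: T_def a_def fun_eq_iff)
    also have "(\<integral>x. (\<Sum>n. T n x) \<partial>M) = I z"
      using T_sums by (simp add: I_def sums_iff)
    finally show ?thesis .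
  qed
  have "I field_differentiable at z" for z
  proof -
    have "I holomorphic_on ball 0 (cmod z + 1)"
      by (rule power_series_holomorphic) (rule I_sums)
    thus ?thesis by (rule holomorphic_on_imp_differentiable_at) auto
  qed
  thus ?thesis unfolding I_def
    by (simp add: holomorphic_on_def field_differentiable_at_within)
qed

section \<open>Interpolation of a bilinear form\<close>

text \<open>On functions bounded above and, off their zero sets, away from zero, the family \<open>z \<mapsto> A(f\<^sub>z, g\<^sub>z)\<close>
  is a single integral \<open>\<integral> w exp (P(z) u)\<close> with bounded \<open>w\<close> and \<open>u\<close>: the exponents combine because
  the same \<open>P(z)\<close> occurs in both arguments. It is therefore entire and bounded in the strip, and
  the endpoint hypotheses are exactly the bounds on its two sides. The convention \<open>ln 0 = 0\<close> does
  no harm, as \<open>sgn\<close> vanishes there.\<close>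

lemma bilinear_riesz_thorin:
  fixes M :: "'a measure" and N :: "'b measure" and K :: "'a \<times> 'b \<Rightarrow> complex"
    and p\<^sub>0 p\<^sub>1 p \<theta> C a b :: real and f :: "'a \<Rightarrow> complex" and g :: "'b \<Rightarrow> complex"
  defines "A \<equiv> \<lambda>f g. \<integral>z. f (fst z) * g (snd z) * K z \<partial>(M \<Otimes>\<^sub>M N)"
  assumes M: "finite_measure M" and N: "finite_measure N"
    and K[measurable]: "K \<in> borel_measurable (M \<Otimes>\<^sub>M N)" and K1: "\<And>z. cmod (K z) \<le> 1"
    and p: "p\<^sub>0 > 0" "p\<^sub>1 > 0" "p > 0" and \<theta>: "0 \<le> \<theta>" "\<theta> \<le> 1"
    and p\<theta>: "1 / p = (1 - \<theta>) / p\<^sub>0 + \<theta> / p\<^sub>1"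
    and C: "C > 0"
    and endpoints: "\<And>f g r s. r \<in> {p\<^sub>0, p\<^sub>1} \<Longrightarrow> f \<in> borel_measurable M \<Longrightarrow> g \<in> borel_measurable N \<Longrightarrow>
      (\<And>x. x \<in> space M \<Longrightarrow> cmod (f x) \<le> s) \<Longrightarrow> (\<And>y. y \<in> space N \<Longrightarrow> cmod (g y) \<le> s) \<Longrightarrow>
      (\<integral>x. cmod (f x) powr r \<partial>M) = 1 \<Longrightarrow> (\<integral>y. cmod (g y) powr r \<partial>N) = 1 \<Longrightarrow>
      cmod (A f g) \<le> C"
    and f[measurable]: "f \<in> borel_measurable M" and g[measurable]: "g \<in> borel_measurable N"
    and a: "a > 0"
    and f_range: "\<And>x. x \<in> space M \<Longrightarrow> f x = 0 \<or> a \<le> cmod (f x) \<and> cmod (f x) \<le> b"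
    and g_range: "\<And>y. y \<in> space N \<Longrightarrow> g y = 0 \<or> a \<le> cmod (g y) \<and> cmod (g y) \<le> b"
    and f1: "(\<integral>x. cmod (f x) powr p \<partial>M) = 1" and g1: "(\<integral>y. cmod (g y) powr p \<partial>N) = 1"
  shows "cmod (A f g) \<le> C"
proof -
  interpret M: finite_measure M by fact
  interpret N: finite_measure N by fact
  interpret MN: pair_sigma_finite M N ..
  have MN: "finite_measure (M \<Otimes>\<^sub>M N)"
    by (rule finite_measure_pair_measure) fact+
  \<comment> \<open>The exponent path: \<open>P z\<close> has real part \<open>1/p\<^sub>0\<close> and \<open>1/p\<^sub>1\<close> on the two sides and equals \<open>1/p\<close> at \<open>\<theta>\<close>.\<close>
  define P :: "complex \<Rightarrow> complex" where "P = (\<lambda>z. (1 - z) / of_real p\<^sub>0 + z / of_real p\<^sub>1)"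
  define twist :: "complex \<Rightarrow> complex \<Rightarrow> complex" where
    "twist = (\<lambda>z c. sgn c * exp (p * P z * ln (cmod c)))"
  have [measurable]: "twist z \<in> borel_measurable borel" for z
    unfolding twist_def by measurable
  have norm_twist: "cmod (twist z c) = cmod c powr (p * Re (P z))" for z c
    by (auto simp: twist_def norm_mult norm_sgn powr_def)
  have twist_\<theta>: "twist \<theta> c = c" for c
  proof -
    have "p * P \<theta> = of_real (p * (1 / p))" unfolding p\<theta> P_def by simp
    also have "\<dots> = 1" using p by simp
    finally show ?thesis
      by (cases "c = 0") (auto simp: twist_def sgn_eq exp_of_real)
  qed
  \<comment> \<open>The integrand of \<open>A(f\<^sub>z, g\<^sub>z)\<close> is \<open>w exp (P z * u)\<close>, and \<open>P\<close> is affine with slope \<open>\<kappa>\<close>.\<close>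
  define w where "w = (\<lambda>z. sgn (f (fst z)) * sgn (g (snd z)) * K z)"
  define u where "u = (\<lambda>z. p * (ln (cmod (f (fst z))) + ln (cmod (g (snd z)))))"
  define l where "l = \<bar>ln a\<bar> + \<bar>ln b\<bar>"
  have ln_le: "\<bar>ln (cmod c)\<bar> \<le> l" if "c = 0 \<or> a \<le> cmod c \<and> cmod c \<le> b" for c :: complex
  proof (cases "c = 0")
    case False
    hence "a \<le> cmod c" "cmod c \<le> b" using that by auto
    hence "ln a \<le> ln (cmod c)" "ln (cmod c) \<le> ln b" using a by (intro ln_mono; linarith)+
    thus ?thesis unfolding l_def by linarith
  qed (auto simp: l_def)
  define \<kappa> where "\<kappa> = 1 / p\<^sub>1 - 1 / p\<^sub>0"
  define \<Phi> where "\<Phi> = (\<lambda>z. A (\<lambda>x. twist z (f x)) (\<lambda>y. twist z (g y)))"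
  have P_eq: "P z = of_real (1 / p\<^sub>0) + z * of_real \<kappa>" for z
    by (simp add: P_def \<kappa>_def algebra_simps diff_divide_distrib)
  have \<Phi>_eq: "\<Phi> z = (\<integral>v. w v * exp (of_real (u v / p\<^sub>0)) * exp (z * of_real (\<kappa> * u v)) \<partial>(M \<Otimes>\<^sub>M N))" for z
    unfolding \<Phi>_def A_def
  proof (rule Bochner_Integration.integral_cong[OF refl])
    fix v
    have "exp (of_real (u v / p\<^sub>0)) * exp (z * of_real (\<kappa> * u v)) = exp (P z * of_real (u v))"
      by (simp add: exp_add[symmetric] P_eq algebra_simps)
    also have "\<dots> = exp (p * P z * ln (cmod (f (fst v)))) * exp (p * P z * ln (cmod (g (snd v))))"
      by (simp add: exp_add[symmetric] u_def algebra_simps)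
    finally show "twist z (f (fst v)) * twist z (g (snd v)) * K v =
        w v * exp (of_real (u v / p\<^sub>0)) * exp (z * of_real (\<kappa> * u v))"
      by (simp add: twist_def w_def)
  qed
  have [measurable]: "w \<in> borel_measurable (M \<Otimes>\<^sub>M N)" "u \<in> borel_measurable (M \<Otimes>\<^sub>M N)"
    unfolding w_def u_def by measurable
  have w1: "cmod (w v) \<le> 1" for v
    unfolding w_def norm_mult norm_sgn using K1[of v] by (simp add: mult_le_one)
  define U where "U = p * (l + l)"
  have u_le: "\<bar>u v\<bar> \<le> U" if "v \<in> space (M \<Otimes>\<^sub>M N)" for v
  proof -
    have "\<bar>ln (cmod (f (fst v))) + ln (cmod (g (snd v)))\<bar> \<le> l + l"
      using ln_le[OF f_range[of "fst v"]] ln_le[OF g_range[of "snd v"]] that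
      by (auto simp: space_pair_measure)
    thus ?thesis using p by (simp add: u_def U_def abs_mult)
  qed
  have w'_le: "cmod (w v * exp (of_real (u v / p\<^sub>0))) \<le> exp (U / p\<^sub>0)" if "v \<in> space (M \<Otimes>\<^sub>M N)" for v
  proof -
    have "u v / p\<^sub>0 \<le> U / p\<^sub>0" using u_le[OF that] p by (intro divide_right_mono) auto
    hence "cmod (exp (of_real (u v / p\<^sub>0))) \<le> exp (U / p\<^sub>0)" by simp
    hence "cmod (w v) * cmod (exp (of_real (u v / p\<^sub>0))) \<le> 1 * exp (U / p\<^sub>0)"
      by (intro mult_mono w1) auto
    thus ?thesis by (simp add: norm_mult)
  qed
  have \<kappa>u_le: "\<bar>\<kappa> * u v\<bar> \<le> \<bar>\<kappa>\<bar> * U" if "v \<in> space (M \<Otimes>\<^sub>M N)" for v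
    using u_le[OF that] by (simp add: abs_mult mult_left_mono)
  have hol: "\<Phi> holomorphic_on UNIV"
    unfolding \<Phi>_eq[abs_def]
    by (rule holomorphic_integral_exp[OF MN _ _ w'_le \<kappa>u_le]) measurable
  define L where "L = exp (U / p\<^sub>0) * exp (\<bar>\<kappa>\<bar> * U) * measure (M \<Otimes>\<^sub>M N) (space (M \<Otimes>\<^sub>M N))"
  have strip: "cmod (\<Phi> z) \<le> L" if "0 \<le> Re z" "Re z \<le> 1" for z
  proof -
    interpret prod: finite_measure "M \<Otimes>\<^sub>M N" by (rule MN)
    have "cmod (w v * exp (of_real (u v / p\<^sub>0)) * exp (z * of_real (\<kappa> * u v))) \<le>
        exp (U / p\<^sub>0) * exp (\<bar>\<kappa>\<bar> * U)" if v: "v \<in> space (M \<Otimes>\<^sub>M N)" for v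
    proof -
      have "Re z * (\<kappa> * u v) \<le> \<bar>Re z * (\<kappa> * u v)\<bar>" by simp
      also have "\<dots> \<le> 1 * (\<bar>\<kappa>\<bar> * U)" unfolding abs_mult[of "Re z"]
        using \<open>0 \<le> Re z\<close> \<open>Re z \<le> 1\<close> \<kappa>u_le[OF v] by (intro mult_mono) auto
      finally have "cmod (exp (z * of_real (\<kappa> * u v))) \<le> exp (\<bar>\<kappa>\<bar> * U)" by simp
      thus ?thesis unfolding norm_mult[of _ "exp (z * of_real (\<kappa> * u v))"]
        by (intro mult_mono w'_le v) auto
    qed
    note bound = this
    have "cmod (\<Phi> z) \<le> (\<integral>v. cmod (w v * exp (of_real (u v / p\<^sub>0)) * exp (z * of_real (\<kappa> * u v))) \<partial>(M \<Otimes>\<^sub>M N))"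
      unfolding \<Phi>_eq by (rule integral_norm_bound)
    also have "\<dots> \<le> (\<integral>v. exp (U / p\<^sub>0) * exp (\<bar>\<kappa>\<bar> * U) \<partial>(M \<Otimes>\<^sub>M N))"
    proof (rule integral_mono)
      show "integrable (M \<Otimes>\<^sub>M N) (\<lambda>v. cmod (w v * exp (of_real (u v / p\<^sub>0)) * exp (z * of_real (\<kappa> * u v))))"
        by (rule integrable_norm, rule prod.integrable_const_bound[OF AE_I2[OF bound]]) auto
    qed (use bound in auto)
    also have "\<dots> = L" by (simp add: L_def)
    finally show ?thesis .
  qed
  \<comment> \<open>Where \<open>Re (P z) = 1/r\<close>, twisting turns \<open>r\<close>-th powers of moduli into \<open>p\<close>-th powers, so both
    arguments are unit vectors for the exponent \<open>r\<close>.\<close>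
  have boundary: "cmod (\<Phi> z) \<le> C" if r: "r \<in> {p\<^sub>0, p\<^sub>1}" and z: "Re (P z) = 1 / r" for z r
  proof -
    have "r > 0" using r p by auto
    have exponent: "cmod (twist z c) powr r = cmod c powr p" for c
      unfolding norm_twist powr_powr z using \<open>r > 0\<close> by simp
    have bounded: "cmod (twist z c) \<le> b powr (p / r)" if "c = 0 \<or> a \<le> cmod c \<and> cmod c \<le> b" for c
      using that \<open>r > 0\<close> p a by (cases "c = 0") (simp_all add: norm_twist z powr_mono2)
    show ?thesis unfolding \<Phi>_def
    proof (rule endpoints[OF r, where s = "b powr (p / r)"])
      show "(\<integral>x. cmod (twist z (f x)) powr r \<partial>M) = 1" "(\<integral>y. cmod (twist z (g y)) powr r \<partial>N) = 1"
        using f1 g1 by (simp_all add: exponent)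
    qed (auto intro!: bounded f_range g_range)
  qed
  have "cmod (\<Phi> \<theta>) \<le> C"
  proof (rule strip_maximum_principle[OF hol C strip])
    show "cmod (\<Phi> z) \<le> C" if "Re z = 0" for z
      using boundary[of "p\<^sub>0" z] that by (simp add: P_eq)
    show "cmod (\<Phi> z) \<le> C" if "Re z = 1" for z
      using boundary[of "p\<^sub>1" z] that by (simp add: P_eq \<kappa>_def)
  qed (use \<theta> in auto)
  thus ?thesis by (simp add: \<Phi>_def twist_\<theta>)
qed

section \<open>Bessel measures and the Fourier operator\<close>

text \<open>The dual form of boundedness of the Fourier operator from \<open>L\<^sup>r(\<mu>)\<close> to \<open>L\<^bsup>r'\<^esup>(\<nu>)\<close>, tested only on bounded unit
  vectors and on sets of finite \<open>\<nu>\<close>-measure. It covers \<open>r = 1\<close> and \<open>r > 1\<close> uniformly, and on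
  sets of finite measure Fubini's theorem is available.\<close>

definition fourier_pairing_bound ::
    "real \<Rightarrow> (real ^ 'd) measure \<Rightarrow> (real ^ 'd) measure \<Rightarrow> real \<Rightarrow> bool" where
  "fourier_pairing_bound r \<mu> \<nu> C \<longleftrightarrow> (\<forall>S f g s.
      S \<in> sets borel \<longrightarrow> emeasure \<nu> S < \<infinity> \<longrightarrow>
      f \<in> borel_measurable \<mu> \<longrightarrow> g \<in> borel_measurable (restrict_space \<nu> S) \<longrightarrow>
      (\<forall>x. cmod (f x) \<le> s) \<longrightarrow> (\<forall>t\<in>S. cmod (g t) \<le> s) \<longrightarrow>
      (\<integral>x. cmod (f x) powr r \<partial>\<mu>) = 1 \<longrightarrow> (\<integral>t. cmod (g t) powr r \<partial>restrict_space \<nu> S) = 1 \<longrightarrow>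
      cmod (\<integral>t. fourier_measure \<mu> f t * g t \<partial>restrict_space \<nu> S) \<le> C)"

lemma fourier_measure_measurable:
  fixes \<mu> :: "(real ^ 'd) measure"
  assumes "sets \<mu> = sets borel" "finite_measure \<mu>" "f \<in> borel_measurable \<mu>"
  shows "fourier_measure \<mu> f \<in> borel_measurable borel"
proof -
  interpret finite_measure \<mu> by fact
  have [measurable_cong]: "sets \<mu> = sets borel" by fact
  have [measurable]: "f \<in> borel_measurable borel" using assms(3) by simp
  show ?thesis unfolding fourier_measure_def by measurable
qed

lemma norm_fourier_kernel:
  "cmod (exp (- 2 * of_real pi * \<i> * of_real s)) = 1"
  by simp

lemma fourier_measure_bound:
  fixes \<mu> :: "(real ^ 'd) measure"
  assumes "finite_measure \<mu>" and "\<And>x. cmod (f x) \<le> s"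
  shows "cmod (fourier_measure \<mu> f t) \<le> s * measure \<mu> (space \<mu>)"
proof -
  interpret finite_measure \<mu> by fact
  have s: "s \<ge> 0" using order_trans[OF norm_ge_zero assms(2)[of undefined]] .
  have "cmod (fourier_measure \<mu> f t) \<le> (\<integral>x. cmod (f x) \<partial>\<mu>)"
    unfolding fourier_measure_def
    by (rule order_trans[OF integral_norm_bound]) (simp add: norm_mult)
  also have "\<dots> \<le> (\<integral>x. s \<partial>\<mu>)"
    using assms(2) s by (intro integral_mono') auto
  finally show ?thesis by (simp add: mult.commute)
qed

text \<open>The constant is \<open>m powr (- (p - 2) / p)\<close> for \<open>m = \<mu>(\<real>\<^sup>d)\<close>. If \<open>m = 0\<close>, the definition of the
  semi-inner product returns \<open>0\<close>, and so does the Fourier transform; any positive constant works.\<close>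

lemma semi_inner_expo:
  fixes \<mu> :: "(real ^ 'd) measure"
  assumes \<mu>: "finite_measure \<mu>" and p: "p \<ge> 1"
  obtains c where "c > 0"
    "\<And>f t. semi_inner p \<mu> f (expo t) = of_real c * fourier_measure \<mu> f t"
proof -
  interpret finite_measure \<mu> by fact
  define m where "m = measure \<mu> (space \<mu>)"
  have norm_expo: "cmod (expo t x) = 1" for t x :: "real ^ 'd"
    by (simp add: expo_def)
  have cnj_expo: "cnj (expo t x) = exp (- 2 * of_real pi * \<i> * of_real (t \<bullet> x))" for t x :: "real ^ 'd"
    by (simp add: expo_def exp_cnj)
  have Lp_expo: "Lp_norm p \<mu> (expo t) = m powr (1 / p)" for t
    by (simp add: Lp_norm_def norm_expo m_def)
  have semi: "semi_inner p \<mu> f (expo t) = (if m powr (1 / p) \<noteq> 0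
     then of_real (1 / (m powr (1 / p)) powr (p - 2)) * fourier_measure \<mu> f t else 0)" for f t
    by (simp add: semi_inner_def Lp_expo norm_expo fourier_measure_def sgn_eq cnj_expo)
  show thesis
  proof (cases "m = 0")
    case True
    hence "AE x in \<mu>. False" by (intro AE_I'[of "space \<mu>"]) (auto simp: m_def emeasure_eq_measure)
    hence "fourier_measure \<mu> f t = 0" for f t
      unfolding fourier_measure_def by (intro integral_eq_zero_AE) auto
    thus thesis using that[of 1] True by (simp add: semi)
  next
    case False
    hence "m > 0" by (simp add: m_def zero_less_measure_iff measure_le_0_iff)
    thus thesis using that[of "1 / (m powr (1 / p)) powr (p - 2)"] False by (simp add: semi)
  qed
qed

text \<open>The positive constant relating semi-inner product and Fourier transform is absorbed into
  the Bessel bound.\<close>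

lemma bessel_measure_iff_fourier:
  fixes \<mu> \<nu> :: "(real ^ 'd) measure"
  assumes \<mu>: "sets \<mu> = sets borel" "finite_measure \<mu>" and \<nu>: "sets \<nu> = sets borel"
    and p: "p \<ge> 1" and q: "q \<noteq> \<infinity>"
  shows "bessel_measure p q \<mu> \<nu> \<longleftrightarrow> (\<exists>B>0. \<forall>f \<in> Lp_space p \<mu>.
    (\<integral>\<^sup>+t. ennreal (cmod (fourier_measure \<mu> f t) powr enn2real q) \<partial>\<nu>)
      \<le> ennreal (B * Lp_norm p \<mu> f powr enn2real q))"
proof -
  obtain c where c: "c > 0"
    and semi: "\<And>f t. semi_inner p \<mu> f (expo t) = of_real c * fourier_measure \<mu> f t"
    using semi_inner_expo[OF \<mu>(2) p] by blast
  define s where "s = enn2real q"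
  define d where "d = c powr s"
  have d: "d > 0" using c by (simp add: d_def)
  define J where "J f = (\<integral>\<^sup>+t. ennreal (cmod (fourier_measure \<mu> f t) powr s) \<partial>\<nu>)" for f
  have semi_J: "(\<integral>\<^sup>+t. ennreal (cmod (semi_inner p \<mu> f (expo t)) powr s) \<partial>\<nu>) = ennreal d * J f"
    if "f \<in> Lp_space p \<mu>" for f
  proof -
    have [measurable]: "fourier_measure \<mu> f \<in> borel_measurable \<nu>"
      using fourier_measure_measurable[OF \<mu>] that \<nu> by (simp add: Lp_space_def cong: measurable_cong_sets)
    show ?thesis using c unfolding J_def
      by (subst nn_integral_cmult[symmetric])
         (auto simp: semi norm_mult powr_mult d_def ennreal_mult' intro!: nn_integral_cong)
  qed
  have scale: "ennreal d * J f \<le> ennreal (B * X) \<longleftrightarrow> J f \<le> ennreal ((B / d) * X)" for B X f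
  proof -
    have "ennreal (B * X) = ennreal d * ennreal ((B / d) * X)"
      using d by (simp flip: ennreal_mult')
    thus ?thesis using d by (simp add: ennreal_mult_le_mult_iff)
  qed
  have "bessel_measure p q \<mu> \<nu> \<longleftrightarrow>
    (\<exists>B>0. \<forall>f \<in> Lp_space p \<mu>. ennreal d * J f \<le> ennreal (B * Lp_norm p \<mu> f powr s))"
    using q unfolding bessel_measure_def s_def[symmetric] by (simp add: semi_J)
  also have "\<dots> \<longleftrightarrow> (\<exists>B>0. \<forall>f \<in> Lp_space p \<mu>. J f \<le> ennreal ((B / d) * Lp_norm p \<mu> f powr s))"
    unfolding scale ..
  also have "\<dots> \<longleftrightarrow> (\<exists>B>0. \<forall>f \<in> Lp_space p \<mu>. J f \<le> ennreal (B * Lp_norm p \<mu> f powr s))"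
    (is "?l \<longleftrightarrow> ?r")
  proof
    assume ?l
    then obtain B where "B > 0" "\<forall>f \<in> Lp_space p \<mu>. J f \<le> ennreal ((B / d) * Lp_norm p \<mu> f powr s)" by blast
    thus ?r using d by (intro exI[of _ "B / d"]) auto
  next
    assume ?r
    then obtain B where "B > 0" "\<forall>f \<in> Lp_space p \<mu>. J f \<le> ennreal (B * Lp_norm p \<mu> f powr s)" by blast
    thus ?l using d by (intro exI[of _ "B * d"]) auto
  qed
  finally show ?thesis by (simp add: J_def s_def)
qed

lemma conjugate_exponents_1: "conjugate_exponents 1 q \<Longrightarrow> q = \<infinity>"
  unfolding conjugate_exponents_def by (cases q) (auto simp: divide_ennreal_def)

lemma conjugate_exponents_gt_1:
  assumes "conjugate_exponents p q" "p > 1"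
  shows "q \<noteq> \<infinity>" "enn2real q > 1" "1 / p + 1 / enn2real q = 1"
proof -
  have eq: "1 / ennreal p + 1 / q = 1" using assms by (simp add: conjugate_exponents_def)
  have inv_p: "1 / ennreal p = ennreal (1 / p)" using assms(2) by (simp add: divide_ennreal flip: ennreal_1)
  show fin: "q \<noteq> \<infinity>"
  proof
    assume "q = \<infinity>"
    hence "ennreal (1 / p) = 1" using eq inv_p by (simp add: divide_ennreal_def)
    thus False using assms(2) by (simp flip: ennreal_1)
  qed
  have "q \<noteq> 0"
  proof
    assume "q = 0"
    thus False using eq by (simp add: divide_ennreal_def)
  qed
  then obtain s where s: "q = ennreal s" "s > 0"
    using fin by (cases q) (auto simp: less_le)
  have inv_q: "1 / q = ennreal (1 / s)" using s by (simp add: divide_ennreal flip: ennreal_1)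
  have "ennreal (1 / p + 1 / s) = ennreal 1"
    using eq assms(2) s unfolding inv_p inv_q by (subst ennreal_plus) auto
  hence sum: "1 / p + 1 / s = 1" using assms(2) s by (subst (asm) ennreal_inj) auto
  thus "1 / p + 1 / enn2real q = 1" using s by simp
  have "1 / p > 0" using assms(2) by simp
  with sum have "1 / s < 1" by linarith
  thus "enn2real q > 1" using s by (simp add: field_simps)
qed

text \<open>For \<open>r > 1\<close>, Young's inequality serves instead of Hoelder's: both norms are bounded by fixed
  constants, and only the existence of some bound is at stake. For \<open>r = 1\<close> the transform is
  essentially bounded and \<open>g\<close> is a unit vector of \<open>L\<^sup>1\<close>.\<close>

lemma pairing_bound_of_bessel:
  fixes \<mu> \<nu> :: "(real ^ 'd) measure"
  assumes \<mu>: "sets \<mu> = sets borel" "finite_measure \<mu>" and \<nu>: "sets \<nu> = sets borel"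
    and conj: "conjugate_exponents r q" and bessel: "bessel_measure r q \<mu> \<nu>"
  obtains C where "C > 0" "fourier_pairing_bound r \<mu> \<nu> C"
proof -
  have r: "r \<ge> 1" using conj by (simp add: conjugate_exponents_def)
  interpret \<mu>: finite_measure \<mu> by fact
  have bounded_Lp: "f \<in> Lp_space r \<mu>" "Lp_norm r \<mu> f = 1"
    if "f \<in> borel_measurable \<mu>" "(\<integral>x. cmod (f x) powr r \<partial>\<mu>) = 1" for f
    using that not_integrable_integral_eq[of \<mu> "\<lambda>x. cmod (f x) powr r"]
    by (auto simp: Lp_space_def Lp_norm_def)
  have restrict: "finite_measure (restrict_space \<nu> S)"
    "space (restrict_space \<nu> S) = S"
    "fourier_measure \<mu> f \<in> borel_measurable (restrict_space \<nu> S)"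
    if "S \<in> sets borel" "emeasure \<nu> S < \<infinity>" "f \<in> borel_measurable \<mu>" for S f
  proof -
    have S: "S \<in> sets \<nu>" "space \<nu> = UNIV" using that \<nu> sets_eq_imp_space_eq[OF \<nu>] by auto
    show "space (restrict_space \<nu> S) = S" using S by (simp add: space_restrict_space)
    show "finite_measure (restrict_space \<nu> S)"
      using S that by (intro finite_measureI) (simp add: emeasure_restrict_space space_restrict_space)
    have "fourier_measure \<mu> f \<in> borel_measurable \<nu>"
      using fourier_measure_measurable[OF \<mu>] that \<nu> by (simp cong: measurable_cong_sets)
    thus "fourier_measure \<mu> f \<in> borel_measurable (restrict_space \<nu> S)"
      by (rule measurable_restrict_space1)
  qed
  show thesis
  proof (cases "r = 1")
    case True
    hence q: "q = \<infinity>" using conj conjugate_exponents_1 by auto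
    obtain B where B: "B > 0" "\<And>f. f \<in> Lp_space r \<mu> \<Longrightarrow>
        esssup \<nu> (\<lambda>t. ennreal (cmod (fourier_measure \<mu> f t))) \<le> ennreal (B * Lp_norm r \<mu> f)"
      using bessel unfolding bessel_measure_def q by auto
    have "cmod (\<integral>t. fourier_measure \<mu> f t * g t \<partial>restrict_space \<nu> S) \<le> B"
      if S: "S \<in> sets borel" "emeasure \<nu> S < \<infinity>"
        and f: "f \<in> borel_measurable \<mu>" and g[measurable]: "g \<in> borel_measurable (restrict_space \<nu> S)"
        and gs: "\<forall>t\<in>S. cmod (g t) \<le> s"
        and f1: "(\<integral>x. cmod (f x) powr r \<partial>\<mu>) = 1"
        and g1: "(\<integral>t. cmod (g t) powr r \<partial>restrict_space \<nu> S) = 1"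
      for S f g s
    proof -
      let ?N = "restrict_space \<nu> S"
      interpret N: finite_measure ?N using restrict(1)[OF S f] .
      have "AE t in \<nu>. ennreal (cmod (fourier_measure \<mu> f t)) \<le> ennreal B"
        using esssup_AE[of "\<lambda>t. ennreal (cmod (fourier_measure \<mu> f t))" \<nu>]
      proof eventually_elim
        case (elim t)
        thus ?case using B(2)[OF bounded_Lp(1)[OF f f1]] bounded_Lp(2)[OF f f1] by simp
      qed
      hence AE: "AE t in ?N. cmod (fourier_measure \<mu> f t) \<le> B"
        using S \<nu> B(1) by (subst AE_restrict_space_iff) auto
      have "cmod (\<integral>t. fourier_measure \<mu> f t * g t \<partial>?N) \<le> (\<integral>t. cmod (fourier_measure \<mu> f t * g t) \<partial>?N)"
        by (rule integral_norm_bound)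
      also have "\<dots> \<le> (\<integral>t. B * cmod (g t) \<partial>?N)"
      proof (rule integral_mono_AE')
        show "integrable ?N (\<lambda>t. B * cmod (g t))"
          using gs restrict(2)[OF S f]
          by (intro integrable_mult_right integrable_norm N.integrable_const_bound[where B = s]) auto
        show "AE t in ?N. cmod (fourier_measure \<mu> f t * g t) \<le> B * cmod (g t)"
          using AE by eventually_elim (auto simp: norm_mult intro!: mult_right_mono)
      qed (use B(1) in auto)
      also have "\<dots> = B" using g1 True by simp
      finally show ?thesis .
    qed
    hence "fourier_pairing_bound r \<mu> \<nu> B"
      unfolding fourier_pairing_bound_def by blast
    thus thesis using B(1) that by blast
  next
    case False
    hence r1: "r > 1" using r by simp
    define s where "s = enn2real q"
    note q = conjugate_exponents_gt_1[OF conj r1, folded s_def]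
    obtain B where B: "B > 0" "\<And>f. f \<in> Lp_space r \<mu> \<Longrightarrow>
        (\<integral>\<^sup>+t. ennreal (cmod (fourier_measure \<mu> f t) powr s) \<partial>\<nu>) \<le> ennreal (B * Lp_norm r \<mu> f powr s)"
      using bessel bessel_measure_iff_fourier[OF \<mu> \<nu> r q(1)] unfolding s_def by auto
    \<comment> \<open>\<open>B\<close> bounds the \<open>s\<close>-th power integral of the transform, and \<open>1\<close> is that of \<open>g\<close> with exponent \<open>r\<close>.\<close>
    have "cmod (\<integral>t. fourier_measure \<mu> f t * g t \<partial>restrict_space \<nu> S) \<le> B + 1"
      if S: "S \<in> sets borel" "emeasure \<nu> S < \<infinity>"
        and f: "f \<in> borel_measurable \<mu>" and g[measurable]: "g \<in> borel_measurable (restrict_space \<nu> S)"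
        and fs: "\<forall>x. cmod (f x) \<le> b" and gs: "\<forall>t\<in>S. cmod (g t) \<le> b"
        and f1: "(\<integral>x. cmod (f x) powr r \<partial>\<mu>) = 1"
        and g1: "(\<integral>t. cmod (g t) powr r \<partial>restrict_space \<nu> S) = 1"
      for S f g b
    proof -
      let ?N = "restrict_space \<nu> S" and ?F = "fourier_measure \<mu> f"
      interpret N: finite_measure ?N using restrict(1)[OF S f] .
      note [measurable] = restrict(3)[OF S f]
      have F_le: "cmod (?F t) \<le> b * measure \<mu> (space \<mu>)" for t
        using fs by (intro fourier_measure_bound[OF \<mu>(2)]) auto
      have int_F: "integrable ?N (\<lambda>t. cmod (?F t) powr s)"
        using F_le q(2)
        by (intro N.integrable_const_bound[where B = "(b * measure \<mu> (space \<mu>)) powr s"] AE_I2)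
           (auto intro!: powr_mono2)
      have int_g: "integrable ?N (\<lambda>t. cmod (g t) powr r)"
        using g1 not_integrable_integral_eq by fastforce
      have "ennreal (\<integral>t. cmod (?F t) powr s \<partial>?N) = (\<integral>\<^sup>+t. ennreal (cmod (?F t) powr s) \<partial>?N)"
        by (intro nn_integral_eq_integral[symmetric] int_F) auto
      also have "\<dots> = (\<integral>\<^sup>+t. ennreal (cmod (?F t) powr s) * indicator S t \<partial>\<nu>)"
        using S \<nu> by (subst nn_integral_restrict_space) auto
      also have "\<dots> \<le> (\<integral>\<^sup>+t. ennreal (cmod (?F t) powr s) \<partial>\<nu>)"
        by (intro nn_integral_mono) (auto split: split_indicator)
      also have "\<dots> \<le> ennreal B"
        using B(2)[OF bounded_Lp(1)[OF f f1]] bounded_Lp(2)[OF f f1] by simp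
      finally have F_B: "(\<integral>t. cmod (?F t) powr s \<partial>?N) \<le> B"
        using B(1) by simp
      have young: "cmod (?F t * g t) \<le> cmod (?F t) powr s + cmod (g t) powr r" for t
      proof -
        have "cmod (?F t * g t) \<le> cmod (?F t) powr s / s + cmod (g t) powr r / r"
          unfolding norm_mult using r1 q by (intro Youngs_inequality) auto
        also have "\<dots> \<le> cmod (?F t) powr s + cmod (g t) powr r"
          using r1 q(2) divide_left_mono[of 1 s "cmod (?F t) powr s"]
            divide_left_mono[of 1 r "cmod (g t) powr r"] by simp
        finally show ?thesis .
      qed
      have "cmod (\<integral>t. ?F t * g t \<partial>?N) \<le> (\<integral>t. cmod (?F t * g t) \<partial>?N)"
        by (rule integral_norm_bound)
      also have "\<dots> \<le> (\<integral>t. cmod (?F t) powr s + cmod (g t) powr r \<partial>?N)"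
        by (intro integral_mono' young Bochner_Integration.integrable_add int_F int_g) auto
      also have "\<dots> = (\<integral>t. cmod (?F t) powr s \<partial>?N) + 1"
        using int_F int_g g1 by simp
      also have "\<dots> \<le> B + 1" using F_B by simp
      finally show ?thesis .
    qed
    hence "fourier_pairing_bound r \<mu> \<nu> (B + 1)"
      unfolding fourier_pairing_bound_def by blast
    thus thesis using B(1) that[of "B + 1"] by simp
  qed
qed

text \<open>Fatou's lemma, in the form in which it removes truncations from an inequality.\<close>

lemma nn_integral_le_of_pointwise_limit:
  fixes u :: "nat \<Rightarrow> 'a \<Rightarrow> ennreal"
  assumes "\<And>n. u n \<in> borel_measurable M" and "\<And>n. (\<integral>\<^sup>+x. u n x \<partial>M) \<le> c"
    and "\<And>x. (\<lambda>n. u n x) \<longlonglongrightarrow> v x"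
  shows "(\<integral>\<^sup>+x. v x \<partial>M) \<le> c"
proof -
  have "(\<integral>\<^sup>+x. v x \<partial>M) = (\<integral>\<^sup>+x. liminf (\<lambda>n. u n x) \<partial>M)"
    using lim_imp_Liminf[OF _ assms(3)] by (intro nn_integral_cong) simp
  also have "\<dots> \<le> liminf (\<lambda>n. \<integral>\<^sup>+x. u n x \<partial>M)"
    by (rule nn_integral_liminf) (rule assms(1))
  also have "\<dots> \<le> liminf (\<lambda>n. c)"
    by (intro Liminf_mono always_eventually allI assms(2))
  finally show ?thesis by (simp add: Liminf_const)
qed

lemma fourier_measure_cmult:
  "fourier_measure \<mu> (\<lambda>x. c * f x) t = c * fourier_measure \<mu> f t"
  by (simp add: fourier_measure_def mult.assoc)

section \<open>The interpolated estimate\<close>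

text \<open>Write \<open>F\<close> for the transform, \<open>I\<close> for the integral of \<open>\<bar>F\<bar> powr q\<close> over \<open>S\<close>, and \<open>n = I powr (1/q)\<close>.
  The test function \<open>g = cnj (sgn F) (\<bar>F\<bar>/n) powr (q/p)\<close> satisfies \<open>\<bar>g\<bar> powr p = \<bar>F\<bar> powr q / I\<close> and, as
  \<open>1 + q/p = q\<close>, also \<open>F g = \<bar>F\<bar> powr q / n powr (q - 1)\<close>. So \<open>g\<close> is a unit vector with \<open>A(f,g) = n\<close>,
  and interpolation gives \<open>n \<le> C\<close>. On \<open>S\<close> the modulus of \<open>F\<close> lies between two positive
  constants, hence so does that of \<open>g\<close>, as the interpolation lemma requires.\<close>

lemma fourier_bound_on_level_set:
  fixes \<mu> \<nu> :: "(real ^ 'd) measure"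
  assumes \<mu>: "sets \<mu> = sets borel" "finite_measure \<mu>" and \<nu>: "sets \<nu> = sets borel"
    and C: "C > 0" "fourier_pairing_bound p\<^sub>0 \<mu> \<nu> C" "fourier_pairing_bound p\<^sub>1 \<mu> \<nu> C"
    and p: "p\<^sub>0 > 0" "p\<^sub>1 > 0" "p > 1" and q: "1 / p + 1 / q = 1"
    and \<theta>: "0 \<le> \<theta>" "\<theta> \<le> 1" "1 / p = (1 - \<theta>) / p\<^sub>0 + \<theta> / p\<^sub>1"
    and f: "f \<in> borel_measurable \<mu>"
    and a: "a > 0" and f_range: "\<And>x. f x = 0 \<or> a \<le> cmod (f x) \<and> cmod (f x) \<le> b"
    and f1: "(\<integral>x. cmod (f x) powr p \<partial>\<mu>) = 1"
    and d: "d > 0" and S: "S = {t. d \<le> cmod (fourier_measure \<mu> f t)}" "emeasure \<nu> S < \<infinity>"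
  shows "(\<integral>\<^sup>+t. ennreal (cmod (fourier_measure \<mu> f t) powr q) * indicator S t \<partial>\<nu>) \<le> ennreal (C powr q)"
proof -
  interpret \<mu>: finite_measure \<mu> by fact
  let ?N = "restrict_space \<nu> S"
  define F where "F = fourier_measure \<mu> f"
  have q_gt: "q > 1" and pq: "1 + q / p = q"
  proof -
    have "q \<noteq> 0" using p q by auto
    hence sum: "q + p = p * q" using p q by (simp add: field_simps)
    thus "1 + q / p = q" using p by (simp add: field_simps)
    have "(p - 1) * q = p" using sum by (simp add: algebra_simps)
    hence "(p - 1) * 1 < (p - 1) * q" by simp
    thus "q > 1" using p by (subst (asm) mult_less_cancel_left_pos) auto
  qed
  have F_borel: "F \<in> borel_measurable borel"
    unfolding F_def using fourier_measure_measurable[OF \<mu> f] .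
  have S_borel: "S \<in> sets borel" unfolding S(1) F_def[symmetric] using F_borel by measurable
  have S_\<nu>: "S \<in> sets \<nu>" "space \<nu> = UNIV" using S_borel \<nu> sets_eq_imp_space_eq[OF \<nu>] by auto
  have space_N: "space ?N = S" using S_\<nu> by (simp add: space_restrict_space)
  have N: "finite_measure ?N"
    using S_\<nu> S(2) by (intro finite_measureI) (simp add: emeasure_restrict_space space_restrict_space)
  interpret N: finite_measure ?N by (rule N)
  interpret \<mu>N: pair_sigma_finite \<mu> ?N ..
  have [measurable]: "F \<in> borel_measurable ?N"
    using F_borel \<nu> by (intro measurable_restrict_space1) (simp cong: measurable_cong_sets)
  have b: "cmod (f x) \<le> \<bar>b\<bar>" for x using f_range[of x] by auto
  define D where "D = \<bar>b\<bar> * measure \<mu> (space \<mu>)"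
  have F_D: "cmod (F t) \<le> D" for t
    unfolding F_def D_def by (intro fourier_measure_bound \<mu>(2) b)
  have F_d: "d \<le> cmod (F t)" if "t \<in> S" for t
    using that by (simp add: S(1) F_def)
  have int_F: "integrable ?N (\<lambda>t. cmod (F t) powr q)"
    using F_D q_gt by (intro N.integrable_const_bound[where B = "D powr q"] AE_I2) (auto intro!: powr_mono2)
  define I where "I = (\<integral>t. cmod (F t) powr q \<partial>?N)"
  have nn_eq: "(\<integral>\<^sup>+t. ennreal (cmod (F t) powr q) * indicator S t \<partial>\<nu>) = ennreal I"
  proof -
    have "(\<integral>\<^sup>+t. ennreal (cmod (F t) powr q) * indicator S t \<partial>\<nu>) = (\<integral>\<^sup>+t. ennreal (cmod (F t) powr q) \<partial>?N)"
      using S_\<nu> by (subst nn_integral_restrict_space) auto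
    also have "\<dots> = ennreal I" unfolding I_def by (intro nn_integral_eq_integral int_F) auto
    finally show ?thesis .
  qed
  have "I \<ge> 0" unfolding I_def by (intro integral_nonneg_AE) auto
  have "I \<le> C powr q"
  proof (cases "I = 0")
    case False
    hence I: "I > 0" using \<open>I \<ge> 0\<close> by simp
    define n where "n = I powr (1 / q)"
    have n: "n > 0" "n powr q = I" using I q_gt by (auto simp: n_def powr_powr)
    define g where "g = (\<lambda>t. cnj (sgn (F t)) * of_real ((cmod (F t) / n) powr (q / p)))"
    have g_meas[measurable]: "g \<in> borel_measurable ?N"
    proof -
      note [measurable] = F_borel
      have [measurable]: "cnj \<in> borel_measurable borel"
        by (intro borel_measurable_continuous_onI continuous_intros)
      have "g \<in> borel_measurable borel" unfolding g_def by measurable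
      thus ?thesis using \<nu> by (intro measurable_restrict_space1) (simp cong: measurable_cong_sets)
    qed
    have norm_g: "cmod (g t) = (cmod (F t) / n) powr (q / p)" for t
      using n by (auto simp: g_def norm_mult norm_sgn)
    have g_p: "cmod (g t) powr p = cmod (F t) powr q / I" for t
      using n p by (simp add: norm_g powr_powr powr_divide)
    have Fg: "F t * g t = of_real (cmod (F t) powr q / n powr (q / p))" for t
    proof (cases "F t = 0")
      case False
      have "F t * g t = of_real (cmod (F t) * cmod (F t) powr (q / p) / n powr (q / p))"
        using False n by (simp add: g_def sgn_eq powr_divide complex_norm_square[symmetric] power2_eq_square field_simps)
      also have "cmod (F t) * cmod (F t) powr (q / p) = cmod (F t) powr q"
        using False powr_add[of "cmod (F t)" 1 "q / p"] pq by simp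
      finally show ?thesis .
    qed (simp add: g_def)
    \<comment> \<open>The kernel of the Fourier operator; Fubini turns the form on the product space into the pairing.\<close>
    define E where "E = (\<lambda>v :: (real ^ 'd) \<times> (real ^ 'd). exp (- 2 * of_real pi * \<i> * of_real (snd v \<bullet> fst v)))"
    have [measurable]: "fst \<in> borel_measurable (\<mu> \<Otimes>\<^sub>M ?N)" "snd \<in> borel_measurable (\<mu> \<Otimes>\<^sub>M ?N)"
    proof -
      show "fst \<in> borel_measurable (\<mu> \<Otimes>\<^sub>M ?N)"
        using measurable_fst[of \<mu> ?N] \<mu>(1) by (simp cong: measurable_cong_sets)
      have "(\<lambda>t. t) \<in> borel_measurable ?N"
        using \<nu> by (intro measurable_restrict_space1) (simp cong: measurable_cong_sets)
      from measurable_compose[OF measurable_snd this] show "snd \<in> borel_measurable (\<mu> \<Otimes>\<^sub>M ?N)" .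
    qed
    have E_meas[measurable]: "E \<in> borel_measurable (\<mu> \<Otimes>\<^sub>M ?N)"
      unfolding E_def by measurable
    have E1: "cmod (E v) = 1" for v unfolding E_def by (rule norm_fourier_kernel)
    have fubini: "(\<integral>v. h (fst v) * k (snd v) * E v \<partial>(\<mu> \<Otimes>\<^sub>M ?N)) =
        (\<integral>t. fourier_measure \<mu> h t * k t \<partial>?N)"
      if [measurable]: "h \<in> borel_measurable \<mu>" "k \<in> borel_measurable ?N"
        and hs: "\<And>x. x \<in> space \<mu> \<Longrightarrow> cmod (h x) \<le> s" and ks: "\<And>y. y \<in> S \<Longrightarrow> cmod (k y) \<le> s" for h k s
    proof -
      interpret prod: finite_measure "\<mu> \<Otimes>\<^sub>M ?N" by (rule finite_measure_pair_measure) fact+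
      have "integrable (\<mu> \<Otimes>\<^sub>M ?N) (\<lambda>v. h (fst v) * k (snd v) * E v)"
        using hs ks order_trans[OF norm_ge_zero hs]
        by (intro prod.integrable_const_bound[where B = "s * s"] AE_I2)
           (auto simp: norm_mult E1 space_pair_measure space_N intro!: mult_mono)
      hence "(\<integral>v. h (fst v) * k (snd v) * E v \<partial>(\<mu> \<Otimes>\<^sub>M ?N)) =
          (\<integral>t. (\<integral>x. h x * k t * E (x, t) \<partial>\<mu>) \<partial>?N)"
        using \<mu>N.integral_snd[of "\<lambda>x t. h x * k t * E (x, t)"] by (simp add: case_prod_beta')
      also have "(\<lambda>t. \<integral>x. h x * k t * E (x, t) \<partial>\<mu>) = (\<lambda>t. fourier_measure \<mu> h t * k t)"
      proof
        fix t
        have "(\<integral>x. h x * k t * E (x, t) \<partial>\<mu>) = (\<integral>x. k t * (h x * E (x, t)) \<partial>\<mu>)"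
          by (simp add: mult_ac)
        also have "\<dots> = k t * fourier_measure \<mu> h t"
          by (simp only: integral_mult_right_zero fourier_measure_def E_def fst_conv snd_conv)
        finally show "(\<integral>x. h x * k t * E (x, t) \<partial>\<mu>) = fourier_measure \<mu> h t * k t" by simp
      qed
      finally show ?thesis .
    qed
    have g_le: "cmod (g t) \<le> (D / n) powr (q / p)" for t
      using F_D[of t] n p q_gt by (auto simp: norm_g intro!: powr_mono2 divide_right_mono)
    have g_ge: "(d / n) powr (q / p) \<le> cmod (g t)" if "t \<in> S" for t
      using F_d[OF that] n p q_gt d by (auto simp: norm_g intro!: powr_mono2 divide_right_mono)
    have "cmod (\<integral>v. f (fst v) * g (snd v) * E v \<partial>(\<mu> \<Otimes>\<^sub>M ?N)) \<le> C"
    proof (rule bilinear_riesz_thorin[OF \<mu>(2) N E_meas _ p(1,2) _ \<theta> C(1),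
          where a = "min a ((d / n) powr (q / p))" and b = "max b ((D / n) powr (q / p))"])
      fix h k r s
      assume r: "r \<in> {p\<^sub>0, p\<^sub>1}" and h: "h \<in> borel_measurable \<mu>" and k: "k \<in> borel_measurable ?N"
        and hs: "\<And>x. x \<in> space \<mu> \<Longrightarrow> cmod (h x) \<le> s" and ks: "\<And>y. y \<in> space ?N \<Longrightarrow> cmod (k y) \<le> s"
        and h1: "(\<integral>x. cmod (h x) powr r \<partial>\<mu>) = 1" and k1: "(\<integral>y. cmod (k y) powr r \<partial>?N) = 1"
      have "fourier_pairing_bound r \<mu> \<nu> C" using r C by auto
      moreover have "\<forall>x. cmod (h x) \<le> s" using hs sets_eq_imp_space_eq[OF \<mu>(1)] by simp
      ultimately have "cmod (\<integral>t. fourier_measure \<mu> h t * k t \<partial>?N) \<le> C"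
        using S_borel S(2) h k ks h1 k1 unfolding fourier_pairing_bound_def space_N by blast
      thus "cmod (\<integral>v. h (fst v) * k (snd v) * E v \<partial>(\<mu> \<Otimes>\<^sub>M ?N)) \<le> C"
        using fubini[OF h k hs] ks by (simp add: space_N)
    next
      show "(\<integral>y. cmod (g y) powr p \<partial>?N) = 1" using I by (simp add: g_p flip: I_def)
      show "0 < min a ((d / n) powr (q / p))" using a d n by simp
      show "f x = 0 \<or> min a ((d / n) powr (q / p)) \<le> cmod (f x) \<and> cmod (f x) \<le> max b ((D / n) powr (q / p))" for x
        using f_range[of x] by auto
      show "g y = 0 \<or> min a ((d / n) powr (q / p)) \<le> cmod (g y) \<and> cmod (g y) \<le> max b ((D / n) powr (q / p))"
        if "y \<in> space ?N" for y
        using g_le[of y] g_ge[of y] that by (auto simp: space_N)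
    qed (use E1 p f f1 in auto)
    also have "(\<integral>v. f (fst v) * g (snd v) * E v \<partial>(\<mu> \<Otimes>\<^sub>M ?N)) = (\<integral>t. F t * g t \<partial>?N)"
      unfolding F_def by (rule fubini[where s = "max \<bar>b\<bar> ((D / n) powr (q / p))"])
        (use f b g_le in \<open>auto simp: le_max_iff_disj\<close>)
    also have "\<dots> = of_real (I / n powr (q / p))"
      unfolding Fg by (simp add: I_def)
    also have "I / n powr (q / p) = n"
      using n powr_add[of n 1 "q / p"] pq by (simp add: field_simps)
    finally have "n \<le> C" using n by simp
    hence "n powr q \<le> C powr q" using n q_gt by (intro powr_mono2) auto
    thus ?thesis using n by simp
  qed (use C in auto)
  thus ?thesis using nn_eq by (simp add: F_def ennreal_leI)
qed

text \<open>By Chebyshev, integrability of some power \<open>s\<close> of the transform makes the level sets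
  \<open>{\<bar>F\<bar> \<ge> 1/(n+1)}\<close> finite, and these exhaust the set where \<open>F \<noteq> 0\<close>.\<close>

lemma fourier_bound_normalized:
  fixes \<mu> \<nu> :: "(real ^ 'd) measure"
  assumes \<mu>: "sets \<mu> = sets borel" "finite_measure \<mu>" and \<nu>: "sets \<nu> = sets borel"
    and C: "C > 0" "fourier_pairing_bound p\<^sub>0 \<mu> \<nu> C" "fourier_pairing_bound p\<^sub>1 \<mu> \<nu> C"
    and p: "p\<^sub>0 > 0" "p\<^sub>1 > 0" "p > 1" and q: "1 / p + 1 / q = 1"
    and \<theta>: "0 \<le> \<theta>" "\<theta> \<le> 1" "1 / p = (1 - \<theta>) / p\<^sub>0 + \<theta> / p\<^sub>1"
    and f: "f \<in> borel_measurable \<mu>"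
    and a: "a > 0" and f_range: "\<And>x. f x = 0 \<or> a \<le> cmod (f x) \<and> cmod (f x) \<le> b"
    and f1: "(\<integral>x. cmod (f x) powr p \<partial>\<mu>) = 1"
    and s: "s > 0" and fin: "(\<integral>\<^sup>+t. ennreal (cmod (fourier_measure \<mu> f t) powr s) \<partial>\<nu>) < \<infinity>"
  shows "(\<integral>\<^sup>+t. ennreal (cmod (fourier_measure \<mu> f t) powr q) \<partial>\<nu>) \<le> ennreal (C powr q)"
proof -
  define F where "F = fourier_measure \<mu> f"
  define S where "S n = {t. 1 / real (Suc n) \<le> cmod (F t)}" for n
  have F_borel: "F \<in> borel_measurable borel"
    unfolding F_def using fourier_measure_measurable[OF \<mu> f] .
  have [measurable]: "F \<in> borel_measurable \<nu>" using F_borel \<nu> by (simp cong: measurable_cong_sets)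
  have "S n \<in> sets borel" for n unfolding S_def using F_borel by measurable
  hence [measurable]: "S n \<in> sets \<nu>" for n using \<nu> by simp
  have S_fin: "emeasure \<nu> (S n) < \<infinity>" for n
  proof -
    have "emeasure \<nu> (S n) = (\<integral>\<^sup>+t. indicator (S n) t \<partial>\<nu>)" by simp
    also have "\<dots> \<le> (\<integral>\<^sup>+t. ennreal (real (Suc n) powr s) * ennreal (cmod (F t) powr s) \<partial>\<nu>)"
    proof (rule nn_integral_mono)
      fix t
      show "indicator (S n) t \<le> ennreal (real (Suc n) powr s) * ennreal (cmod (F t) powr s)"
      proof (cases "t \<in> S n")
        case True
        hence "1 \<le> real (Suc n) * cmod (F t)" by (simp add: S_def field_simps)
        hence "1 \<le> (real (Suc n) * cmod (F t)) powr s" using s by (intro ge_one_powr_ge_zero) auto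
        thus ?thesis using True by (simp add: powr_mult flip: ennreal_mult' ennreal_1)
      qed simp
    qed
    also have "\<dots> = ennreal (real (Suc n) powr s) * (\<integral>\<^sup>+t. ennreal (cmod (F t) powr s) \<partial>\<nu>)"
      by (rule nn_integral_cmult) measurable
    also have "\<dots> < \<infinity>" using fin by (simp add: F_def ennreal_mult_less_top)
    finally show ?thesis .
  qed
  have "(\<integral>\<^sup>+t. ennreal (cmod (F t) powr q) \<partial>\<nu>) \<le> ennreal (C powr q)"
  proof (rule nn_integral_le_of_pointwise_limit)
    show "(\<integral>\<^sup>+t. ennreal (cmod (F t) powr q) * indicator (S n) t \<partial>\<nu>) \<le> ennreal (C powr q)" for n
      unfolding F_def
      by (rule fourier_bound_on_level_set[OF \<mu> \<nu> C p q \<theta> f a f_range f1, of "1 / real (Suc n)"])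
         (use S_fin in \<open>auto simp: S_def F_def\<close>)
    show "(\<lambda>n. ennreal (cmod (F t) powr q) * indicator (S n) t) \<longlonglongrightarrow> ennreal (cmod (F t) powr q)" for t
    proof (cases "F t = 0")
      case False
      have "(\<lambda>n. 1 / real (Suc n)) \<longlonglongrightarrow> 0" using LIMSEQ_inverse_real_of_nat by (simp add: inverse_eq_divide)
      hence "eventually (\<lambda>n. 1 / real (Suc n) < cmod (F t)) sequentially"
        using False by (intro order_tendstoD) auto
      hence "eventually (\<lambda>n. ennreal (cmod (F t) powr q) * indicator (S n) t = ennreal (cmod (F t) powr q)) sequentially"
        by eventually_elim (auto simp: S_def)
      thus ?thesis by (rule tendsto_eventually)
    qed simp
  qed measurable
  thus ?thesis by (simp add: F_def)
qed

text \<open>Cutting \<open>f\<close> off to \<open>1/(n+1) \<le> \<bar>f\<bar> \<le> n+1\<close> decreases its norm, and the transforms converge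
  pointwise: \<open>\<mu>\<close> being finite, \<open>f\<close> is integrable and dominates its truncations.\<close>

lemma fourier_bound_of_truncated:
  fixes \<mu> \<nu> :: "(real ^ 'd) measure"
  assumes \<mu>: "sets \<mu> = sets borel" "finite_measure \<mu>" and \<nu>: "sets \<nu> = sets borel"
    and p: "p \<ge> 1" and s: "s > 0" and c: "c \<ge> 0"
    and truncated: "\<And>f a b. f \<in> borel_measurable \<mu> \<Longrightarrow> a > 0 \<Longrightarrow>
      (\<And>x. f x = 0 \<or> a \<le> cmod (f x) \<and> cmod (f x) \<le> b) \<Longrightarrow>
      (\<integral>\<^sup>+t. ennreal (cmod (fourier_measure \<mu> f t) powr s) \<partial>\<nu>)
        \<le> ennreal (c * Lp_norm p \<mu> f powr s)"
    and f_Lp: "f \<in> Lp_space p \<mu>"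
  shows "(\<integral>\<^sup>+t. ennreal (cmod (fourier_measure \<mu> f t) powr s) \<partial>\<nu>)
    \<le> ennreal (c * Lp_norm p \<mu> f powr s)"
proof (rule nn_integral_le_of_pointwise_limit)
  interpret finite_measure \<mu> by fact
  have f[measurable]: "f \<in> borel_measurable \<mu>" and int_p: "integrable \<mu> (\<lambda>x. cmod (f x) powr p)"
    using f_Lp by (auto simp: Lp_space_def)
  define h where "h = (\<lambda>n x. if 1 / real (Suc n) \<le> cmod (f x) \<and> cmod (f x) \<le> real (Suc n) then f x else 0)"
  have h[measurable]: "h n \<in> borel_measurable \<mu>" for n unfolding h_def by measurable
  have h_le: "cmod (h n x) \<le> cmod (f x)" for n x by (simp add: h_def)
  show "(\<lambda>t. ennreal (cmod (fourier_measure \<mu> (h n) t) powr s)) \<in> borel_measurable \<nu>" for n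
  proof -
    have [measurable]: "fourier_measure \<mu> (h n) \<in> borel_measurable \<nu>"
      using fourier_measure_measurable[OF \<mu> h] \<nu> by (simp cong: measurable_cong_sets)
    show ?thesis by measurable
  qed
  show "(\<integral>\<^sup>+t. ennreal (cmod (fourier_measure \<mu> (h n) t) powr s) \<partial>\<nu>)
      \<le> ennreal (c * Lp_norm p \<mu> f powr s)" for n
  proof -
    have "Lp_norm p \<mu> (h n) \<le> Lp_norm p \<mu> f" unfolding Lp_norm_def
      using p h_le int_p
      by (intro powr_mono2 integral_mono' integral_nonneg_AE) (auto intro!: powr_mono2)
    hence "c * Lp_norm p \<mu> (h n) powr s \<le> c * Lp_norm p \<mu> f powr s"
      using s c by (intro mult_left_mono powr_mono2) (auto simp: Lp_norm_def)
    moreover have "(\<integral>\<^sup>+t. ennreal (cmod (fourier_measure \<mu> (h n) t) powr s) \<partial>\<nu>)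
        \<le> ennreal (c * Lp_norm p \<mu> (h n) powr s)"
      by (rule truncated[of "h n" "1 / real (Suc n)" "real (Suc n)"]) (auto simp: h_def intro: h)
    ultimately show ?thesis by (meson ennreal_leI order_trans)
  qed
  have int_f: "integrable \<mu> f"
  proof (rule Bochner_Integration.integrable_bound)
    show "integrable \<mu> (\<lambda>x. 1 + cmod (f x) powr p)" using int_p by auto
    have "cmod (f x) \<le> 1 + cmod (f x) powr p" for x
    proof (cases "cmod (f x) \<le> 1")
      case False
      hence "cmod (f x) powr 1 \<le> cmod (f x) powr p" using p by (intro powr_mono) auto
      thus ?thesis using False by simp
    qed (simp add: add_increasing2)
    thus "AE x in \<mu>. norm (f x) \<le> norm (1 + cmod (f x) powr p)" by (auto intro!: AE_I2)
  qed measurable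
  have h_lim: "(\<lambda>n. h n x) \<longlonglongrightarrow> f x" for x
  proof (cases "f x = 0")
    case False
    have "(\<lambda>n. 1 / real (Suc n)) \<longlonglongrightarrow> 0" using LIMSEQ_inverse_real_of_nat by (simp add: inverse_eq_divide)
    hence "eventually (\<lambda>n. 1 / real (Suc n) < cmod (f x)) sequentially"
      using False by (intro order_tendstoD) auto
    moreover have "eventually (\<lambda>n. cmod (f x) \<le> real (Suc n)) sequentially"
      by real_asymp
    ultimately have "eventually (\<lambda>n. h n x = f x) sequentially"
      by eventually_elim (simp add: h_def)
    thus ?thesis by (rule tendsto_eventually)
  qed (simp add: h_def)
  have "(\<lambda>n. fourier_measure \<mu> (h n) t) \<longlonglongrightarrow> fourier_measure \<mu> f t" for t
    unfolding fourier_measure_def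
  proof (rule integral_dominated_convergence)
    have [measurable_cong]: "sets \<mu> = sets borel" by (rule \<mu>)
    have [measurable]: "f \<in> borel_measurable borel" "\<And>n. h n \<in> borel_measurable borel"
      using f h \<mu> by (simp_all cong: measurable_cong_sets)
    show "(\<lambda>x. f x * exp (- 2 * of_real pi * \<i> * of_real (t \<bullet> x))) \<in> borel_measurable \<mu>"
      "\<And>n. (\<lambda>x. h n x * exp (- 2 * of_real pi * \<i> * of_real (t \<bullet> x))) \<in> borel_measurable \<mu>"
      by measurable
    show "integrable \<mu> (\<lambda>x. cmod (f x))" using int_f by auto
  qed (auto intro!: tendsto_intros h_lim AE_I2 simp: norm_mult h_le)
  thus "(\<lambda>n. ennreal (cmod (fourier_measure \<mu> (h n) t) powr s)) \<longlonglongrightarrow> ennreal (cmod (fourier_measure \<mu> f t) powr s)" for t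
    using s by (intro tendsto_ennrealI tendsto_powr2 tendsto_norm tendsto_const) auto
qed

theorem proposition3p12:
  fixes \<mu> \<nu> :: "(real ^ 'd) measure"
    and p\<^sub>0 p\<^sub>1 p :: real
    and q\<^sub>0 q\<^sub>1 q :: ennreal
  assumes "sets \<mu> = sets borel" and "finite_measure \<mu>"
    and "sets \<nu> = sets borel"
    and "1 \<le> p\<^sub>0" and "p\<^sub>0 < p\<^sub>1"
    and "conjugate_exponents p\<^sub>0 q\<^sub>0" and "conjugate_exponents p\<^sub>1 q\<^sub>1"
    and "bessel_measure p\<^sub>0 q\<^sub>0 \<mu> \<nu>" and "bessel_measure p\<^sub>1 q\<^sub>1 \<mu> \<nu>"
    and "p\<^sub>0 < p" and "p < p\<^sub>1"
    and "conjugate_exponents p q"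
  shows "bessel_measure p q \<mu> \<nu>"
proof -
  note \<mu> = assms(1,2) and \<nu> = assms(3)
  interpret finite_measure \<mu> by fact
  have p: "p\<^sub>0 > 0" "p\<^sub>1 > 0" "p > 1" "p\<^sub>1 > 1" using assms by auto
  define s where "s = enn2real q"
  note q = conjugate_exponents_gt_1[OF assms(12) p(3), folded s_def]
  note q\<^sub>1 = conjugate_exponents_gt_1[OF assms(7) p(4)]
  obtain C\<^sub>0 where C\<^sub>0: "C\<^sub>0 > 0" "fourier_pairing_bound p\<^sub>0 \<mu> \<nu> C\<^sub>0"
    using pairing_bound_of_bessel[OF \<mu> \<nu> assms(6,8)] by blast
  obtain C\<^sub>1 where C\<^sub>1: "C\<^sub>1 > 0" "fourier_pairing_bound p\<^sub>1 \<mu> \<nu> C\<^sub>1"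
    using pairing_bound_of_bessel[OF \<mu> \<nu> assms(7,9)] by blast
  define C where "C = max C\<^sub>0 C\<^sub>1"
  have C: "C > 0" "fourier_pairing_bound p\<^sub>0 \<mu> \<nu> C" "fourier_pairing_bound p\<^sub>1 \<mu> \<nu> C"
    using C\<^sub>0 C\<^sub>1 unfolding C_def fourier_pairing_bound_def by (auto simp: le_max_iff_disj)
  \<comment> \<open>The solution of \<open>1/p = (1 - \<theta>)/p\<^sub>0 + \<theta>/p\<^sub>1\<close>.\<close>
  define \<theta> where "\<theta> = (1 / p\<^sub>0 - 1 / p) / (1 / p\<^sub>0 - 1 / p\<^sub>1)"
  have lt: "1 / p < 1 / p\<^sub>0" "1 / p\<^sub>1 < 1 / p" using assms p by (auto simp: field_simps)
  have \<theta>: "0 \<le> \<theta>" "\<theta> \<le> 1" using lt by (auto simp: \<theta>_def)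
  have \<theta>_eq: "1 / p = (1 - \<theta>) / p\<^sub>0 + \<theta> / p\<^sub>1"
  proof -
    have "(1 - \<theta>) / p\<^sub>0 + \<theta> / p\<^sub>1 = 1 / p\<^sub>0 - \<theta> * (1 / p\<^sub>0 - 1 / p\<^sub>1)"
      by (simp add: algebra_simps diff_divide_distrib)
    also have "\<theta> * (1 / p\<^sub>0 - 1 / p\<^sub>1) = 1 / p\<^sub>0 - 1 / p"
      unfolding \<theta>_def using lt by (intro nonzero_eq_divide_eq[THEN iffD1]) linarith+
    finally show ?thesis by simp
  qed
  have truncated: "(\<integral>\<^sup>+t. ennreal (cmod (fourier_measure \<mu> f t) powr s) \<partial>\<nu>)
      \<le> ennreal (C powr s * Lp_norm p \<mu> f powr s)"
    if f[measurable]: "f \<in> borel_measurable \<mu>" and a: "a > 0"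
      and f_range: "\<And>x. f x = 0 \<or> a \<le> cmod (f x) \<and> cmod (f x) \<le> b" for f a b
  proof -
    have f_Lp: "integrable \<mu> (\<lambda>x. cmod (f x) powr r)" if "r > 0" for r
    proof (rule integrable_const_bound[where B = "\<bar>b\<bar> powr r"])
      have "cmod (f x) \<le> \<bar>b\<bar>" for x using f_range[of x] by auto
      thus "AE x in \<mu>. norm (cmod (f x) powr r) \<le> \<bar>b\<bar> powr r"
        using \<open>r > 0\<close> by (auto intro!: AE_I2 powr_mono2)
    qed measurable
    have int_nonneg: "(\<integral>x. cmod (f x) powr p \<partial>\<mu>) \<ge> 0" by (intro integral_nonneg_AE) auto
    define n where "n = Lp_norm p \<mu> f"
    have n_p: "n powr p = (\<integral>x. cmod (f x) powr p \<partial>\<mu>)"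
      using p int_nonneg by (simp add: n_def Lp_norm_def powr_powr)
    \<comment> \<open>Homogeneity reduces to unit vectors; a null vector has zero transform.\<close>
    show ?thesis
    proof (cases "n = 0")
      case True
      hence "(\<integral>x. cmod (f x) powr p \<partial>\<mu>) = 0" using n_p by simp
      hence "AE x in \<mu>. cmod (f x) powr p = 0"
        by (subst (asm) integral_nonneg_eq_0_iff_AE) (use f_Lp p in auto)
      hence "AE x in \<mu>. f x = 0" by simp
      hence "fourier_measure \<mu> f t = 0" for t
        unfolding fourier_measure_def by (intro integral_eq_zero_AE) auto
      thus ?thesis by simp
    next
      case False
      hence n: "n > 0" by (simp add: n_def Lp_norm_def)
      define h where "h = (\<lambda>x. of_real (1 / n) * f x)"
      have h_meas[measurable]: "h \<in> borel_measurable \<mu>" unfolding h_def by measurable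
      have norm_h: "cmod (h x) = cmod (f x) / n" for x using n by (simp add: h_def norm_mult norm_divide)
      have f_h: "fourier_measure \<mu> f t = of_real n * fourier_measure \<mu> h t" for t
        using n unfolding h_def fourier_measure_cmult by simp
      have h_int: "integrable \<mu> (\<lambda>x. cmod (h x) powr p\<^sub>1)"
        using f_Lp[OF p(2)] n by (simp add: norm_h powr_divide)
      have [measurable]: "fourier_measure \<mu> h \<in> borel_measurable \<nu>"
        using fourier_measure_measurable[OF \<mu> h_meas] \<nu> by (simp cong: measurable_cong_sets)
      have "(\<integral>\<^sup>+t. ennreal (cmod (fourier_measure \<mu> h t) powr s) \<partial>\<nu>) \<le> ennreal (C powr s)"
      proof (rule fourier_bound_normalized[OF \<mu> \<nu> C p(1-3) q(3) \<theta> \<theta>_eq h_meas, of "a / n" "b / n" "enn2real q\<^sub>1"])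
        show "h x = 0 \<or> a / n \<le> cmod (h x) \<and> cmod (h x) \<le> b / n" for x
        proof -
          have "h x = 0 \<longleftrightarrow> f x = 0" using n by (simp add: h_def)
          thus ?thesis using f_range[of x] n by (auto simp: norm_h intro: divide_right_mono)
        qed
        show "(\<integral>x. cmod (h x) powr p \<partial>\<mu>) = 1"
          using n n_p[symmetric] by (simp add: norm_h powr_divide)
        \<comment> \<open>The second endpoint, where \<open>q\<^sub>1\<close> is finite, supplies an integrable power of the transform.\<close>
        obtain B where "B > 0" "\<And>f. f \<in> Lp_space p\<^sub>1 \<mu> \<Longrightarrow>
            (\<integral>\<^sup>+t. ennreal (cmod (fourier_measure \<mu> f t) powr enn2real q\<^sub>1) \<partial>\<nu>)
              \<le> ennreal (B * Lp_norm p\<^sub>1 \<mu> f powr enn2real q\<^sub>1)"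
          using bessel_measure_iff_fourier[OF \<mu> \<nu> _ q\<^sub>1(1), of p\<^sub>1] assms(9) p by auto
        from this(2)[of h] show "(\<integral>\<^sup>+t. ennreal (cmod (fourier_measure \<mu> h t) powr enn2real q\<^sub>1) \<partial>\<nu>) < \<infinity>"
          using h_int h_meas by (auto simp: Lp_space_def intro: le_less_trans)
      qed (use a n q q\<^sub>1 in auto)
      hence "ennreal (n powr s) * (\<integral>\<^sup>+t. ennreal (cmod (fourier_measure \<mu> h t) powr s) \<partial>\<nu>)
          \<le> ennreal (n powr s) * ennreal (C powr s)"
        by (intro mult_left_mono) auto
      also have "ennreal (n powr s) * (\<integral>\<^sup>+t. ennreal (cmod (fourier_measure \<mu> h t) powr s) \<partial>\<nu>)
          = (\<integral>\<^sup>+t. ennreal (cmod (fourier_measure \<mu> f t) powr s) \<partial>\<nu>)"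
        using n by (subst nn_integral_cmult[symmetric])
          (auto simp: f_h norm_mult powr_mult ennreal_mult' intro!: nn_integral_cong)
      also have "ennreal (n powr s) * ennreal (C powr s) = ennreal (C powr s * n powr s)"
        by (simp add: mult.commute flip: ennreal_mult')
      finally show ?thesis by (simp add: n_def)
    qed
  qed
  have "(\<integral>\<^sup>+t. ennreal (cmod (fourier_measure \<mu> f t) powr s) \<partial>\<nu>)
      \<le> ennreal (C powr s * Lp_norm p \<mu> f powr s)" if "f \<in> Lp_space p \<mu>" for f
  proof (rule fourier_bound_of_truncated[OF \<mu> \<nu> _ _ _ _ that])
    show "(\<integral>\<^sup>+t. ennreal (cmod (fourier_measure \<mu> f t) powr s) \<partial>\<nu>)
        \<le> ennreal (C powr s * Lp_norm p \<mu> f powr s)"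
      if "f \<in> borel_measurable \<mu>" "a > 0"
        "\<And>x. f x = 0 \<or> a \<le> cmod (f x) \<and> cmod (f x) \<le> b" for f a b
      using that by (rule truncated)
  qed (use p q in auto)
  thus ?thesis
    using bessel_measure_iff_fourier[OF \<mu> \<nu> _ q(1), of p] p C
    by (auto simp: s_def intro!: exI[of _ "C powr s"])
qed

end
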